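(* For every integer $n\ge 3$, it holds that $\chi_{\rm pcf}(\mathrm{SK}_n)=n$, where $\mathrm{SK}_n$ is the graph obtained from the complete graph $K_n$ by subdividing every edge exactly once.
   Context: All graphs are simple, finite and undirected. A vertex coloring of a graph is proper if adjacent vertices get distinct colors. It is conflict-free (with respect to open neighborhoods) if for every non-isolated vertex $x$ there is a color that appears exactly once on the open neighborhood $N(x)$. A PCF $k$-coloring is a vertex coloring with at most $k$ colors that is both proper and conflict-free. The PCF chromatic number $\chi_{\rm pcf}(G)$ is the minimum $k$ for which $G$ admits a PCF $k$-coloring. Subdividing an edge $uv$ once means replacing it by a path $u\,w\,v$ with $w$ a new vertex of degree 2. *)

theory Defs
  imports "Graph_Theory.Graph_Theory"
begin

text \<open>
  Finite simple undirected graphs are taken in the sense of the locale \<open>graph\<close>: finite,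
  loop-free, symmetric digraphs without parallel arcs. An undirected edge \<open>uv\<close> is thus the
  pair of arcs from \<open>u\<close> to \<open>v\<close> and from \<open>v\<close> to \<open>u\<close>.
\<close>

definition open_nbhd :: "('a, 'b) pre_digraph \<Rightarrow> 'a \<Rightarrow> 'a set" where
  "open_nbhd G x = {y. x \<rightarrow>\<^bsub>G\<^esub> y}"

definition proper_coloring :: "('a, 'b) pre_digraph \<Rightarrow> ('a \<Rightarrow> nat) \<Rightarrow> bool" where
  "proper_coloring G c \<longleftrightarrow> (\<forall>u v. u \<rightarrow>\<^bsub>G\<^esub> v \<longrightarrow> c u \<noteq> c v)"

definition conflict_free_coloring :: "('a, 'b) pre_digraph \<Rightarrow> ('a \<Rightarrow> nat) \<Rightarrow> bool" where
  "conflict_free_coloring G c \<longleftrightarrow>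
     (\<forall>x\<in>verts G. open_nbhd G x \<noteq> {} \<longrightarrow> (\<exists>a. \<exists>!y. y \<in> open_nbhd G x \<and> c y = a))"

definition pcf_coloring :: "('a, 'b) pre_digraph \<Rightarrow> nat \<Rightarrow> ('a \<Rightarrow> nat) \<Rightarrow> bool" where
  "pcf_coloring G k c \<longleftrightarrow>
     c ` verts G \<subseteq> {..<k} \<and> proper_coloring G c \<and> conflict_free_coloring G c"

definition pcf_chromatic_number :: "('a, 'b) pre_digraph \<Rightarrow> nat" where
  "pcf_chromatic_number G = (LEAST k. \<exists>c. pcf_coloring G k c)"

text \<open>
  Subdividing every edge exactly once: \<open>Inl v\<close> is the original vertex \<open>v\<close>, and
  \<open>Inr {u, v}\<close> is the new vertex of degree 2 on the edge \<open>uv\<close>, the same one for both arcs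
  of that edge.
\<close>

definition full_subdivision :: "('a, 'b) pre_digraph \<Rightarrow> ('a + 'a set) pair_pre_digraph" where
  "full_subdivision G =
     \<lparr> pverts = Inl ` verts G \<union> {Inr {u, v} | u v. u \<rightarrow>\<^bsub>G\<^esub> v},
       parcs = {(Inl u, Inr {u, v}) | u v. u \<rightarrow>\<^bsub>G\<^esub> v} \<union> {(Inr {u, v}, Inl u) | u v. u \<rightarrow>\<^bsub>G\<^esub> v} \<rparr>"

lemma graph_full_subdivision:
  assumes "graph G"
  shows "graph (full_subdivision G)"
proof -
  interpret graph G by fact
  have fin: "finite (arcs_ends G)" by (simp add: arcs_ends_def)
  have eqs: "{Inr {u, v} | u v. u \<rightarrow>\<^bsub>G\<^esub> v} = (\<lambda>(u, v). Inr {u, v}) ` arcs_ends G"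
    "{(Inl u, Inr {u, v}) | u v. u \<rightarrow>\<^bsub>G\<^esub> v} = (\<lambda>(u, v). (Inl u, Inr {u, v})) ` arcs_ends G"
    "{(Inr {u, v}, Inl u) | u v. u \<rightarrow>\<^bsub>G\<^esub> v} = (\<lambda>(u, v). (Inr {u, v}, Inl u)) ` arcs_ends G"
    by auto
  have "pair_graph (full_subdivision G)"
  proof
    show "finite (pverts (full_subdivision G))" "finite (parcs (full_subdivision G))"
      unfolding full_subdivision_def eqs using fin by simp_all
    show "symmetric (full_subdivision G)"
      by (auto simp: symmetric_def full_subdivision_def intro!: symI)
  qed (auto simp: full_subdivision_def dest: adj_in_verts)
  then show ?thesis by (rule pair_graph.pair_graphD_graph)
qed

lemma ex_pcf_coloring:
  assumes "graph G"
  shows "\<exists>k c. pcf_coloring G k c"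
proof -
  interpret graph G by fact
  obtain c :: "'a \<Rightarrow> nat" and k where c: "c ` verts G = {i. i < k}" "inj_on c (verts G)"
    using finite_imp_inj_to_nat_seg[OF finite_verts] by metis
  have "proper_coloring G c"
    using c(2) adj_in_verts adj_not_same unfolding proper_coloring_def by (metis inj_onD)
  moreover have "conflict_free_coloring G c"
    unfolding conflict_free_coloring_def
  proof (intro ballI impI)
    fix x assume "x \<in> verts G" "open_nbhd G x \<noteq> {}"
    then obtain y where y: "y \<in> open_nbhd G x" by blast
    have "open_nbhd G x \<subseteq> verts G" by (auto simp: open_nbhd_def dest: adj_in_verts)
    then have "inj_on c (open_nbhd G x)" by (rule inj_on_subset[OF c(2)])
    then have "\<exists>!z. z \<in> open_nbhd G x \<and> c z = c y"
      using y by (auto dest: inj_onD)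
    then show "\<exists>a. \<exists>!z. z \<in> open_nbhd G x \<and> c z = a" by blast
  qed
  ultimately show ?thesis using c(1) by (auto simp: pcf_coloring_def)
qed

lemma ex_complete_digraph: "\<exists>G :: nat pair_pre_digraph. K\<^bsub>n\<^esub> (with_proj G)"
  by (rule exI[of _ "\<lparr> pverts = {..<n}, parcs = {(u, v). u < n \<and> v < n \<and> u \<noteq> v} \<rparr>"])
    (simp add: complete_digraph_pair_def)

end

theory Submission
  imports Defs
begin

text \<open>
  Both neighbours of a subdivision vertex must get distinct colours, so the \<open>n\<close> original
  vertices are pairwise distinguished, which forces \<open>n\<close> colours. Conversely, give the original
  vertices the colours \<open>0, \<dots>, n - 1\<close>, colour the subdivision vertices on edges avoiding
  vertex \<open>0\<close> with \<open>0\<close>, the one on the edge \<open>01\<close> with \<open>2\<close> and those on the other edges \<open>0j\<close>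
  with \<open>1\<close>. Then vertex \<open>0\<close> sees \<open>2\<close> exactly once, and every vertex \<open>j > 0\<close> sees a nonzero
  colour only through the edge \<open>0j\<close>.
\<close>

lemma parcs_full_subdivision_iff [simp]:
  "(Inl u, Inr S) \<in> parcs (full_subdivision G) \<longleftrightarrow> (\<exists>v. S = {u, v} \<and> u \<rightarrow>\<^bsub>G\<^esub> v)"
  "(Inr S, Inl u) \<in> parcs (full_subdivision G) \<longleftrightarrow> (\<exists>v. S = {u, v} \<and> u \<rightarrow>\<^bsub>G\<^esub> v)"
  "(Inl u, Inl v) \<notin> parcs (full_subdivision G)"
  "(Inr S, Inr T) \<notin> parcs (full_subdivision G)"
  by (auto simp: full_subdivision_def)

lemma pverts_full_subdivision:
  "pverts (full_subdivision G) = Inl ` verts G \<union> {Inr {u, v} | u v. u \<rightarrow>\<^bsub>G\<^esub> v}"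
  by (simp add: full_subdivision_def)

lemma open_nbhd_full_subdivision_Inl:
  "open_nbhd (full_subdivision G) (Inl u) = {Inr {u, v} | v. u \<rightarrow>\<^bsub>G\<^esub> v}"
proof (intro set_eqI)
  fix y show "y \<in> open_nbhd (full_subdivision G) (Inl u) \<longleftrightarrow> y \<in> {Inr {u, v} | v. u \<rightarrow>\<^bsub>G\<^esub> v}"
    by (cases y) (auto simp: open_nbhd_def)
qed

lemma open_nbhd_full_subdivision_Inr:
  assumes "graph G" "u \<rightarrow>\<^bsub>G\<^esub> v"
  shows "open_nbhd (full_subdivision G) (Inr {u, v}) = {Inl u, Inl v}"
proof (intro set_eqI)
  interpret graph G by fact
  \<comment> \<open>The arc from \<open>Inr {u, v}\<close> to \<open>Inl v\<close> comes from an arc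
    of \<open>G\<close> that starts at \<open>v\<close>, hence the reversed arc.\<close>
  have "v \<rightarrow>\<^bsub>G\<^esub> u" using assms(2) arcs_ends_symmetric[OF sym_arcs] by blast
  then show "y \<in> open_nbhd (full_subdivision G) (Inr {u, v}) \<longleftrightarrow> y \<in> {Inl u, Inl v}" for y
    using assms(2) by (cases y) (auto simp: open_nbhd_def doubleton_eq_iff)
qed

text \<open>The subdivision vertex on \<open>uv\<close> sees only \<open>Inl u\<close> and
  \<open>Inl v\<close>. If these shared a colour, it would appear twice there and no colour exactly
  once.\<close>

lemma conflict_free_full_subdivision_adj_neq:
  assumes "graph G" "u \<rightarrow>\<^bsub>G\<^esub> v" "conflict_free_coloring (full_subdivision G) c"
  shows "c (Inl u) \<noteq> c (Inl v)"
proof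
  interpret graph G by fact
  assume eq: "c (Inl u) = c (Inl v)"
  have "Inr {u, v} \<in> verts (full_subdivision G)"
    using assms(2) unfolding with_proj_simps pverts_full_subdivision by blast
  then obtain a where "\<exists>!y. y \<in> {Inl u, Inl v} \<and> c y = a"
    using assms(3) open_nbhd_full_subdivision_Inr[OF assms(1,2)]
    unfolding conflict_free_coloring_def by (metis insert_not_empty)
  moreover have "u \<noteq> v" using assms(2) adj_not_same by metis
  ultimately show False using eq by (metis Inl_inject insertCI insertE singletonD)
qed

lemma complete_digraph_adj_iff:
  assumes "K\<^bsub>n\<^esub> G"
  shows "u \<rightarrow>\<^bsub>G\<^esub> v \<longleftrightarrow> u \<in> verts G \<and> v \<in> verts G \<and> u \<noteq> v"
  using assms by (auto simp: complete_digraph_def)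

text \<open>Any two vertices of a complete graph are adjacent, so the previous lemma makes the
  colouring injective on the original vertices.\<close>

lemma pcf_coloring_full_subdivision_complete_ge:
  assumes K: "K\<^bsub>n\<^esub> G" and "pcf_coloring (full_subdivision G) k c"
  shows "n \<le> k"
proof -
  have "graph G" using K by (simp add: complete_digraph_def)
  then have "inj_on (\<lambda>v. c (Inl v)) (verts G)"
    using assms(2) conflict_free_full_subdivision_adj_neq
    by (fastforce simp: inj_on_def pcf_coloring_def complete_digraph_adj_iff[OF K])
  moreover have "(\<lambda>v. c (Inl v)) ` verts G \<subseteq> {..<k}"
    using assms(2) by (auto simp: pcf_coloring_def pverts_full_subdivision image_Un)
  ultimately have "card (verts G) \<le> card {..<k}" by (intro card_inj_on_le) auto
  then show ?thesis using K by (simp add: complete_digraph_def)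
qed

lemma pcf_coloring_full_subdivision_complete_ex:
  fixes G :: "('a, 'b) pre_digraph"
  assumes K: "K\<^bsub>n\<^esub> G" and n: "n \<ge> 3"
  shows "\<exists>c. pcf_coloring (full_subdivision G) n c"
proof -
  have graph: "graph G" and card: "card (verts G) = n" using K by (auto simp: complete_digraph_def)
  interpret graph G by fact
  note adj = complete_digraph_adj_iff[OF K]
  obtain h :: "'a \<Rightarrow> nat" where h: "bij_betw h (verts G) {..<n}"
    using ex_bij_betw_finite_nat[OF finite_verts] card by (auto simp: atLeast0LessThan)
  have inj: "h x = h y \<longleftrightarrow> x = y" if "x \<in> verts G" "y \<in> verts G" for x y
    using h that by (auto simp: bij_betw_def inj_on_def)
  have hlt: "h x < n" if "x \<in> verts G" for x using h that by (auto simp: bij_betw_def)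
  have surj: "\<exists>x\<in>verts G. h x = i" if "i < n" for i
    using h that unfolding bij_betw_def by (metis imageE lessThan_iff)
  obtain z where z: "z \<in> verts G" "h z = 0" using surj[of 0] n by auto
  obtain w where w: "w \<in> verts G" "h w = 1" using surj[of 1] n by auto
  have zw: "z \<noteq> w" using z w by auto
  \<comment> \<open>Here \<open>z\<close> and \<open>w\<close> act as the vertices 0 and 1. The edge
    \<open>zw\<close> cannot take colour 1, which \<open>w\<close> already has; its colour 2 is
    available because \<open>n\<close> is at least 3.\<close>
  define g where "g S = (if z \<in> S then if w \<in> S then 2 else 1 else 0 :: nat)" for S
  define c where "c = case_sum h g"
  have c [simp]: "c (Inl x) = h x" "c (Inr S) = g S" for x S by (simp_all add: c_def)
  \<comment> \<open>Colour 0 sits only on edges that miss \<open>z\<close>, the sole vertex numbered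
    0; colour 1 only on edges that miss \<open>w\<close>; and the ends of \<open>zw\<close> have
    colours 0 and 1, not 2.\<close>
  have neq: "h u \<noteq> g {u, v}" if "u \<rightarrow>\<^bsub>G\<^esub> v" for u v
    using that z w zw inj[of u z] inj[of u w] by (auto simp: g_def adj)
  have "c ` verts (full_subdivision G) \<subseteq> {..<n}"
    using n by (auto simp: pverts_full_subdivision hlt g_def)
  moreover have "proper_coloring (full_subdivision G) c"
    unfolding proper_coloring_def
  proof (intro allI impI)
    fix x y assume "x \<rightarrow>\<^bsub>full_subdivision G\<^esub> y"
    then show "c x \<noteq> c y"
      by (cases x; cases y) (auto simp: neq dest!: neq)
  qed
  moreover have "conflict_free_coloring (full_subdivision G) c"
    unfolding conflict_free_coloring_def
  proof (intro ballI impI)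
    fix x assume "x \<in> verts (full_subdivision G)"
    then consider (subdiv) u v where "x = Inr {u, v}" "u \<rightarrow>\<^bsub>G\<^esub> v"
      | (zero) "x = Inl z" | (other) j where "x = Inl j" "j \<in> verts G" "j \<noteq> z"
      unfolding with_proj_simps pverts_full_subdivision by blast
    then show "\<exists>a. \<exists>!y. y \<in> open_nbhd (full_subdivision G) x \<and> c y = a"
    proof cases
      case subdiv
      \<comment> \<open>The numbering \<open>h\<close> separates the two ends, so the colour of
        either one is unique.\<close>
      have "\<exists>!y. y \<in> {Inl u, Inl v} \<and> c y = h u"
        using subdiv(2) inj[of u v] by (intro ex1I[of _ "Inl u"]) (auto simp: adj)
      then show ?thesis
        using subdiv open_nbhd_full_subdivision_Inr[OF graph] by auto
    next
      case zero
      have uniq: "v = w" if "z \<rightarrow>\<^bsub>G\<^esub> v" "g {z, v} = 2" for v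
        using that zw by (auto simp: g_def split: if_splits)
      have "z \<rightarrow>\<^bsub>G\<^esub> w" "g {z, w} = 2" using z w zw by (auto simp: g_def adj)
      then have "\<exists>!y. y \<in> {Inr {z, v} | v. z \<rightarrow>\<^bsub>G\<^esub> v} \<and> c y = 2"
        by (intro ex1I[of _ "Inr {z, w}"]) (auto dest: uniq)
      then show ?thesis unfolding zero open_nbhd_full_subdivision_Inl by (rule exI)
    next
      case other
      \<comment> \<open>The colour on the edge \<open>jz\<close> is 2 if \<open>j = w\<close> and 1
        otherwise; arguing with any nonzero colour treats both cases at once.\<close>
      have uniq: "v = z" if "j \<rightarrow>\<^bsub>G\<^esub> v" "g {j, v} \<noteq> 0" for v
        using that other by (auto simp: g_def split: if_splits)
      have "j \<rightarrow>\<^bsub>G\<^esub> z" "g {j, z} \<noteq> 0" using other z by (auto simp: g_def adj)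
      then have "\<exists>!y. y \<in> {Inr {j, v} | v. j \<rightarrow>\<^bsub>G\<^esub> v} \<and> c y = g {j, z}"
        by (intro ex1I[of _ "Inr {j, z}"]) (auto dest: uniq)
      then show ?thesis unfolding other(1) open_nbhd_full_subdivision_Inl by (rule exI)
    qed
  qed
  ultimately show ?thesis unfolding pcf_coloring_def by blast
qed

theorem mainTheorem3:
  fixes n :: nat and G :: "('a, 'b) pre_digraph"
  assumes "n \<ge> 3" and "K\<^bsub>n\<^esub> G"
  shows "pcf_chromatic_number (full_subdivision G) = n"
  unfolding pcf_chromatic_number_def
  using pcf_coloring_full_subdivision_complete_ex[OF assms(2,1)]
    pcf_coloring_full_subdivision_complete_ge[OF assms(2)]
  by (intro Least_equality) auto

end
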